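(* Let $$A=\Big\{x:\lim_{n\to\infty}\frac1n\log q_n(x)=\frac{\gamma_0}2\Big\},\quad B=\Big\{x:\lim_{n\to\infty}\frac1n\sum_{j=1}^n\log a_j(x)=0\Big\},\quad C=\Big\{x:\lim_{n\to\infty}\frac1n\sharp N_n(x)=0\Big\},$$ where $x$ ranges over the irrational numbers in $[0,1]$. Then $A=B\subset C$.
   Context: For irrational $x\in[0,1]$, $x=[a_1(x),a_2(x),\dots]$ is its continued fraction expansion, $q_n(x)$ is the denominator of its $n$-th convergent $p_n/q_n=[a_1(x),\dots,a_n(x)]$ (so $q_{-1}=0$, $q_0=1$, $q_n=a_nq_{n-1}+q_{n-2}$), $N_n(x)=\{j\le n:a_j(x)\ne1\}$, $\sharp$ denotes cardinality, and $\gamma_0=2\log\frac{1+\sqrt5}2$. *)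

theory Defs
  imports "HOL-Analysis.Analysis"
begin

definition gauss_map :: "real \<Rightarrow> real" where
  "gauss_map x = frac (1 / x)"

text \<open>Digits are indexed from \<open>1\<close>; the value at index \<open>0\<close> is junk and is never used.\<close>

definition cf_digit :: "real \<Rightarrow> nat \<Rightarrow> int" where
  "cf_digit x n = \<lfloor>1 / (gauss_map ^^ (n - 1)) x\<rfloor>"

text \<open>The finite continued fraction \<open>[a\<^sub>1, \<dots>, a\<^sub>n] = 1 / (a\<^sub>1 + 1 / (\<dots> + 1 / a\<^sub>n))\<close>,
  with value \<open>0\<close> for the empty list.\<close>

definition cf_val :: "int list \<Rightarrow> rat" where
  "cf_val as = foldr (\<lambda>a r. 1 / (of_int a + r)) as 0"

definition cf_convergent :: "real \<Rightarrow> nat \<Rightarrow> rat" where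
  "cf_convergent x n = cf_val (map (cf_digit x) [1..<Suc n])"

definition cf_denom :: "real \<Rightarrow> nat \<Rightarrow> int" where
  "cf_denom x n = snd (quotient_of (cf_convergent x n))"

definition non_one_indices :: "real \<Rightarrow> nat \<Rightarrow> nat set" where
  "non_one_indices x n = {j \<in> {1..n}. cf_digit x j \<noteq> 1}"

definition gamma0 :: real where
  "gamma0 = 2 * ln ((1 + sqrt 5) / 2)"

definition unit_irrationals :: "real set" where
  "unit_irrationals = {0..1} - \<rat>"


lemma gauss_map_irrational:
  assumes "x \<in> unit_irrationals"
  shows "gauss_map x \<in> unit_irrationals"
proof -
  have "1 / x \<notin> \<rat>"
    using assms Rats_inverse[of "1 / x"] by (auto simp: unit_irrationals_def inverse_eq_divide)
  moreover have "1 / x = frac (1 / x) + of_int \<lfloor>1 / x\<rfloor>"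
    by (simp add: frac_def)
  ultimately have "frac (1 / x) \<notin> \<rat>"
    by (metis Rats_add Rats_of_int)
  thus ?thesis
    using frac_ge_0[of "1 / x"] frac_lt_1[of "1 / x"]
    by (simp add: unit_irrationals_def gauss_map_def)
qed

lemma cf_digit_pos:
  assumes "x \<in> unit_irrationals"
  shows "cf_digit x n \<ge> 1"
proof -
  have "(gauss_map ^^ k) x \<in> unit_irrationals" for k
    by (induction k) (use assms gauss_map_irrational in auto)
  hence "(gauss_map ^^ (n - 1)) x \<in> {0..1} - {0}"
    unfolding unit_irrationals_def using Rats_0 by (metis Diff_iff singletonD)
  thus ?thesis
    by (simp add: cf_digit_def le_floor_iff)
qed

text \<open>Continuants, shifted by one: \<open>continuant u v a (Suc n)\<close> is the \<open>n\<close>-th one, and the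
  values at indices \<open>-1\<close> and \<open>0\<close> are \<open>u\<close> and \<open>v\<close>.\<close>

fun continuant :: "int \<Rightarrow> int \<Rightarrow> (nat \<Rightarrow> int) \<Rightarrow> nat \<Rightarrow> int" where
  "continuant u v a 0 = u"
| "continuant u v a (Suc 0) = v"
| "continuant u v a (Suc (Suc n)) =
     a (Suc n) * continuant u v a (Suc n) + continuant u v a n"

lemma continuant_denom_nonneg:
  assumes "\<And>n. a n \<ge> 1"
  shows "continuant 0 1 a n \<ge> 0 \<and> continuant 0 1 a (Suc n) \<ge> 1"
proof (induction n)
  case (Suc n)
  have "1 * 1 \<le> a (Suc n) * continuant 0 1 a (Suc n)"
    using assms[of "Suc n"] Suc by (intro mult_mono) auto
  thus ?case using Suc by simp
qed simp

lemma continuant_det: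
  "continuant 1 0 a (Suc n) * continuant 0 1 a n -
   continuant 1 0 a n * continuant 0 1 a (Suc n) = (-1) ^ Suc n"
proof (induction n)
  case (Suc n)
  thus ?case by (simp add: algebra_simps)
qed simp

lemma foldr_continuant:
  fixes t :: rat
  assumes "\<And>n. a n \<ge> 1" and "t \<ge> 0"
  shows "foldr (\<lambda>a r. 1 / (of_int a + r)) (map a [1..<Suc n]) t =
    (of_int (continuant 1 0 a (Suc n)) + t * of_int (continuant 1 0 a n)) /
    (of_int (continuant 0 1 a (Suc n)) + t * of_int (continuant 0 1 a n))"
  using assms(2)
proof (induction n arbitrary: t)
  case (Suc n)
  define s where "s = 1 / (of_int (a (Suc n)) + t)"
  have a: "of_int (a (Suc n)) \<ge> (1::rat)"
    using assms(1)[of "Suc n"] by simp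
  hence s: "s > 0" and s': "of_int (a (Suc n)) + t > 0"
    using Suc.prems by (auto simp: s_def intro!: divide_pos_pos add_pos_nonneg)
  have key: "(of_int (a (Suc n)) + t) * (of_int (continuant u v a (Suc n)) + s * of_int (continuant u v a n))
     = of_int (continuant u v a (Suc (Suc n))) + t * of_int (continuant u v a (Suc n))" for u v
    using s' by (simp add: s_def field_simps)
  have "foldr (\<lambda>a r. 1 / (of_int a + r)) (map a [1..<Suc (Suc n)]) t =
        foldr (\<lambda>a r. 1 / (of_int a + r)) (map a [1..<Suc n]) s"
    by (simp add: s_def)
  also have "\<dots> = (of_int (continuant 1 0 a (Suc n)) + s * of_int (continuant 1 0 a n)) /
    (of_int (continuant 0 1 a (Suc n)) + s * of_int (continuant 0 1 a n))"
    using s by (intro Suc.IH) simp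
  also have "\<dots> =
    ((of_int (a (Suc n)) + t) * (of_int (continuant 1 0 a (Suc n)) + s * of_int (continuant 1 0 a n))) /
    ((of_int (a (Suc n)) + t) * (of_int (continuant 0 1 a (Suc n)) + s * of_int (continuant 0 1 a n)))"
    using s' by simp
  finally show ?case unfolding key .
qed simp

lemma cf_denom_continuant:
  assumes "x \<in> unit_irrationals"
  shows "cf_denom x n = continuant 0 1 (cf_digit x) (Suc n)"
proof -
  let ?p = "continuant 1 0 (cf_digit x)" and ?q = "continuant 0 1 (cf_digit x)"
  have pos: "\<And>n. cf_digit x n \<ge> 1"
    using cf_digit_pos[OF assms] .
  have "cf_convergent x n = of_int (?p (Suc n)) / of_int (?q (Suc n))"
    using foldr_continuant[of "cf_digit x" 0 n, OF pos]
    by (simp add: cf_convergent_def cf_val_def)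
  hence "cf_convergent x n = Fract (?p (Suc n)) (?q (Suc n))"
    by (simp add: Fract_of_int_quotient)
  moreover have "coprime (?p (Suc n)) (?q (Suc n))"
  proof (rule coprimeI)
    fix d assume "d dvd ?p (Suc n)" "d dvd ?q (Suc n)"
    hence "d dvd ?p (Suc n) * ?q n - ?p n * ?q (Suc n)"
      by simp
    hence "d dvd (-1) ^ Suc n"
      by (simp only: continuant_det)
    moreover have "(-1 :: int) ^ Suc n dvd 1"
      by (metis dvd_refl is_unit_power_iff minus_dvd_iff)
    ultimately show "is_unit d"
      using dvd_trans by blast
  qed
  moreover have "?q (Suc n) > 0"
    using continuant_denom_nonneg[of "cf_digit x" n, OF pos] by linarith
  ultimately show ?thesis
    by (simp add: cf_denom_def quotient_of_Fract normalize_stable)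
qed

lemma cf_denom_0: "x \<in> unit_irrationals \<Longrightarrow> cf_denom x 0 = 1"
  and cf_denom_1: "x \<in> unit_irrationals \<Longrightarrow> cf_denom x 1 = cf_digit x 1"
  and cf_denom_rec: "x \<in> unit_irrationals \<Longrightarrow>
    cf_denom x (n + 2) = cf_digit x (n + 2) * cf_denom x (n + 1) + cf_denom x n"
  by (simp_all add: cf_denom_continuant)

end

theory Submission
  imports Defs
begin

text \<open>
  Write \<open>\<phi>\<close> for the golden ratio and \<open>S\<^sub>n = \<Sum>\<^sub>j\<^sub>\<le>\<^sub>n ln a\<^sub>j\<close>. Everything follows from the two-sided bound
  \<open>(n - 1) ln \<phi> + S\<^sub>n / \<phi>\<^sup>2 \<le> ln q\<^sub>n \<le> n ln \<phi> + S\<^sub>n\<close>. The upper bound is immediate from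
  \<open>q\<^sub>n \<le> a\<^sub>n (q\<^sub>n\<^sub>-\<^sub>1 + q\<^sub>n\<^sub>-\<^sub>2)\<close>. For the lower bound, consider \<open>L\<^sub>n = \<phi> q\<^sub>n + q\<^sub>n\<^sub>-\<^sub>1\<close>, the functional that a
  digit \<open>1\<close> multiplies by exactly \<open>\<phi>\<close>: a digit \<open>a\<close> multiplies it by at least
  \<open>\<phi> (1 + (a - 1) / \<phi>\<^sup>2)\<close>, which is at least \<open>\<phi> a powr (1 / \<phi>\<^sup>2)\<close> by concavity of the logarithm.
\<close>

definition golden_ratio :: real where
  "golden_ratio = (1 + sqrt 5) / 2"

lemma golden_ratio_gt_1: "golden_ratio > 1"
  by (simp add: golden_ratio_def)

lemma golden_ratio_square: "golden_ratio\<^sup>2 = golden_ratio + 1"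
  by (simp add: golden_ratio_def power2_eq_square field_simps)

lemma mult_ln_le_ln_affine:
  fixes a c :: real
  assumes "a > 0" "0 \<le> c" "c \<le> 1"
  shows "c * ln a \<le> ln (1 + c * (a - 1))"
  using concave_onD[OF ln_concave, of c 1 a] assms by (simp add: algebra_simps)

context
  fixes a :: "nat \<Rightarrow> int"
  assumes a_ge_1: "\<And>n. a n \<ge> 1"
begin

lemma continuant_denom_Suc_mono: "continuant 0 1 a n \<le> continuant 0 1 a (Suc n)"
proof (cases n)
  case (Suc m)
  have "1 * continuant 0 1 a (Suc m) \<le> a (Suc m) * continuant 0 1 a (Suc m)"
    using a_ge_1 continuant_denom_nonneg[of a, OF a_ge_1] by (intro mult_right_mono) auto
  thus ?thesis
    using continuant_denom_nonneg[of a m, OF a_ge_1] unfolding Suc continuant.simps by linarith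
qed simp

lemma continuant_denom_le:
  "real_of_int (continuant 0 1 a (Suc n)) \<le> golden_ratio ^ n * (\<Prod>j = 1..n. real_of_int (a j))"
proof (induction n rule: less_induct)
  case (less n)
  consider "n = 0" | "n = 1" | m where "n = Suc (Suc m)"
    by (metis One_nat_def not0_implies_Suc)
  thus ?case
  proof cases
    case 2
    have "1 * real_of_int (a 1) \<le> golden_ratio * real_of_int (a 1)"
      using golden_ratio_gt_1 a_ge_1[of 1] by (intro mult_right_mono) auto
    thus ?thesis using 2 by simp
  next
    case 3
    define P where "P k = (\<Prod>j = 1..k. real_of_int (a j))" for k
    define x where "x = real_of_int (a n)"
    define y where "y = real_of_int (a (Suc m))"
    define q where "q k = real_of_int (continuant 0 1 a (Suc k))" for k
    have x: "x \<ge> 1" and y: "y \<ge> 1"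
      using a_ge_1 by (simp_all add: x_def y_def)
    have P: "P (Suc m) = P m * y" "P n = P m * y * x"
      by (simp_all add: P_def x_def y_def 3)
    have Pm: "P m \<ge> 0"
      unfolding P_def using order_trans[OF zero_le_one a_ge_1] by (intro prod_nonneg) simp
    have nonneg: "0 \<le> golden_ratio ^ m * P m"
      using Pm golden_ratio_gt_1 by simp
    have IH: "q m \<le> golden_ratio ^ m * P m" "q (Suc m) \<le> golden_ratio ^ Suc m * P (Suc m)"
      using less[of m] less[of "Suc m"] 3 by (simp_all only: q_def P_def lessI less_SucI)
    have "q n = x * q (Suc m) + q m"
      by (simp add: q_def x_def 3)
    also have "\<dots> \<le> x * (golden_ratio ^ Suc m * P (Suc m)) + golden_ratio ^ m * P m"
      using IH x by (intro add_mono mult_left_mono) auto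
    also have "golden_ratio ^ m * P m \<le> (y * x) * (golden_ratio ^ m * P m)"
      using mult_mono[OF y x] y nonneg mult_right_mono[of 1 "y * x"] by simp
    also have "x * (golden_ratio ^ Suc m * P (Suc m)) + (y * x) * (golden_ratio ^ m * P m)
        = (golden_ratio + 1) * golden_ratio ^ m * P n"
      by (simp add: P algebra_simps)
    also have "\<dots> = golden_ratio ^ n * P n"
      unfolding golden_ratio_square[symmetric] by (simp add: 3 power2_eq_square)
    finally show ?thesis by (simp add: q_def P_def)
  qed simp
qed

lemma ln_continuant_denom_le:
  "ln (real_of_int (continuant 0 1 a (Suc n)))
     \<le> real n * ln golden_ratio + (\<Sum>j = 1..n. ln (real_of_int (a j)))"
proof -
  have pos: "real_of_int (a j) > 0" for j
    using a_ge_1[of j] by simp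
  have "ln (real_of_int (continuant 0 1 a (Suc n)))
      \<le> ln (golden_ratio ^ n * (\<Prod>j = 1..n. real_of_int (a j)))"
    using continuant_denom_le[of n] continuant_denom_nonneg[of a n, OF a_ge_1] by simp
  also have "\<dots> = real n * ln golden_ratio + (\<Sum>j = 1..n. ln (real_of_int (a j)))"
    using golden_ratio_gt_1 pos
    by (simp add: ln_mult ln_realpow ln_prod prod_pos less_imp_neq[THEN not_sym])
  finally show ?thesis .
qed

lemma ln_golden_functional_ge:
  "real (Suc n) * ln golden_ratio + (\<Sum>j = 1..n. ln (real_of_int (a j))) / golden_ratio\<^sup>2
     \<le> ln (golden_ratio * continuant 0 1 a (Suc n) + continuant 0 1 a n)"
proof (induction n)
  case (Suc n)
  define u where "u = real_of_int (continuant 0 1 a (Suc n))"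
  define v where "v = real_of_int (continuant 0 1 a n)"
  define x where "x = real_of_int (a (Suc n))"
  define L where "L = golden_ratio * u + v"
  define c where "c = 1 / golden_ratio\<^sup>2"
  have x: "x \<ge> 1"
    using a_ge_1 by (simp add: x_def)
  have u: "u \<ge> 1" "v \<ge> 0" "v \<le> u"
    using continuant_denom_nonneg[of a n, OF a_ge_1] continuant_denom_Suc_mono[of n]
    by (simp_all add: u_def v_def)
  have c: "0 < c" "c \<le> 1"
    using golden_ratio_gt_1 by (simp_all add: c_def)
  have L: "L > 0"
    using u golden_ratio_gt_1 by (auto simp: L_def intro!: add_pos_nonneg mult_pos_pos)
  have "L \<le> golden_ratio\<^sup>2 * u"
    using u by (simp add: L_def golden_ratio_square algebra_simps)
  hence Lu: "c * L \<le> u"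
    using golden_ratio_gt_1 by (simp add: c_def field_simps)
  have "ln (golden_ratio * L) + c * ln x \<le> ln (golden_ratio * L) + ln (1 + c * (x - 1))"
    using mult_ln_le_ln_affine[of x c] x c by simp
  also have "\<dots> = ln (golden_ratio * L * (1 + c * (x - 1)))"
    using L golden_ratio_gt_1 x c by (intro ln_mult_pos[symmetric] add_pos_nonneg) auto
  also have "golden_ratio * L * (1 + c * (x - 1))
      = golden_ratio * L + golden_ratio * (x - 1) * (c * L)"
    by (simp add: algebra_simps)
  also have "ln \<dots> \<le> ln (golden_ratio * L + golden_ratio * (x - 1) * u)"
  proof -
    have "golden_ratio * (x - 1) * (c * L) \<le> golden_ratio * (x - 1) * u"
      using Lu x golden_ratio_gt_1 by (intro mult_left_mono) auto
    moreover have "golden_ratio * L > 0" "golden_ratio * (x - 1) * (c * L) \<ge> 0"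
      using L x c golden_ratio_gt_1 by auto
    ultimately show ?thesis by (intro ln_mono) linarith+
  qed
  also have "golden_ratio * L + golden_ratio * (x - 1) * u
      = golden_ratio\<^sup>2 * u + golden_ratio * v + golden_ratio * (x - 1) * u"
    by (simp add: L_def power2_eq_square algebra_simps)
  also have "\<dots> = golden_ratio * (x * u + v) + u"
    unfolding golden_ratio_square by (simp add: algebra_simps)
  finally have "ln golden_ratio + ln L + c * ln x \<le> ln (golden_ratio * (x * u + v) + u)"
    using L golden_ratio_gt_1 by (simp add: ln_mult)
  moreover have "real (Suc n) * ln golden_ratio + c * (\<Sum>j = 1..n. ln (real_of_int (a j))) \<le> ln L"
    using Suc by (simp add: L_def u_def v_def c_def)
  ultimately show ?case
    by (simp add: u_def v_def x_def c_def algebra_simps add_divide_distrib)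
qed simp

lemma ln_continuant_denom_ge:
  "(real n - 1) * ln golden_ratio + (\<Sum>j = 1..n. ln (real_of_int (a j))) / golden_ratio\<^sup>2
     \<le> ln (real_of_int (continuant 0 1 a (Suc n)))"
proof -
  define u where "u = real_of_int (continuant 0 1 a (Suc n))"
  define v where "v = real_of_int (continuant 0 1 a n)"
  have u: "u \<ge> 1" "v \<ge> 0" "v \<le> u"
    using continuant_denom_nonneg[of a n, OF a_ge_1] continuant_denom_Suc_mono[of n]
    by (simp_all add: u_def v_def)
  have "golden_ratio * u + v \<le> golden_ratio\<^sup>2 * u"
    using u by (simp add: golden_ratio_square algebra_simps)
  moreover have "golden_ratio * u + v > 0"
    using u golden_ratio_gt_1 by (auto intro!: add_pos_nonneg mult_pos_pos)
  ultimately have "ln (golden_ratio * u + v) \<le> ln (golden_ratio\<^sup>2 * u)"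
    by (intro ln_mono)
  also have "\<dots> = 2 * ln golden_ratio + ln u"
    using u golden_ratio_gt_1 by (simp add: ln_mult ln_realpow)
  finally show ?thesis
    using ln_golden_functional_ge[of n] by (simp add: u_def v_def algebra_simps)
qed

end

lemma ln_cf_denom_limit_iff:
  assumes "x \<in> unit_irrationals"
  shows "(\<lambda>n. 1 / real n * ln (real_of_int (cf_denom x n))) \<longlonglongrightarrow> ln golden_ratio \<longleftrightarrow>
    (\<lambda>n. 1 / real n * (\<Sum>j = 1..n. ln (real_of_int (cf_digit x j)))) \<longlonglongrightarrow> 0"
    (is "?Q \<longlonglongrightarrow> ?l \<longleftrightarrow> ?S \<longlonglongrightarrow> 0")
proof -
  have digit: "\<And>j. cf_digit x j \<ge> 1"
    using cf_digit_pos[OF assms] .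
  have S_nonneg: "0 \<le> ?S n" for n
    using digit by (auto intro!: mult_nonneg_nonneg divide_nonneg_nonneg sum_nonneg)
  have upper: "?Q n \<le> ?l + ?S n" if "n > 0" for n
    using ln_continuant_denom_le[of "cf_digit x" n, OF digit] that
    by (simp add: cf_denom_continuant[OF assms] field_simps)
  have lower: "?l - ?l / real n + ?S n / golden_ratio\<^sup>2 \<le> ?Q n" if "n > 0" for n
    using divide_right_mono[OF ln_continuant_denom_ge[of "cf_digit x" n, OF digit], of "real n"] that
    by (simp add: cf_denom_continuant[OF assms] add_divide_distrib diff_divide_distrib algebra_simps)
  have shift: "(\<lambda>n. ?l / real n) \<longlonglongrightarrow> 0"
    by (rule lim_const_over_n)
  show ?thesis
  proof
    assume Q: "?Q \<longlonglongrightarrow> ?l"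
    have "?S n \<le> golden_ratio\<^sup>2 * (?Q n - ?l + ?l / real n)" if "n > 0" for n
    proof -
      have "?S n / golden_ratio\<^sup>2 \<le> ?Q n - ?l + ?l / real n"
        using lower[OF that] by linarith
      thus ?thesis
        using golden_ratio_gt_1 by (subst (asm) pos_divide_le_eq) (auto simp: mult.commute)
    qed
    moreover have "(\<lambda>n. golden_ratio\<^sup>2 * (?Q n - ?l + ?l / real n)) \<longlonglongrightarrow> golden_ratio\<^sup>2 * (?l - ?l + 0)"
      by (intro tendsto_intros Q shift)
    ultimately show "?S \<longlonglongrightarrow> 0"
      using S_nonneg
      by (intro tendsto_sandwich[of "\<lambda>_. 0" ?S _ "\<lambda>n. golden_ratio\<^sup>2 * (?Q n - ?l + ?l / real n)"])
         (auto intro: eventually_mono[OF eventually_gt_at_top[of 0]])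
  next
    assume S: "?S \<longlonglongrightarrow> 0"
    have "?l - ?l / real n \<le> ?Q n" if "n > 0" for n
      using lower[OF that] S_nonneg[of n] by (smt (verit) divide_nonneg_nonneg zero_le_power2)
    moreover have "(\<lambda>n. ?l - ?l / real n) \<longlonglongrightarrow> ?l - 0" "(\<lambda>n. ?l + ?S n) \<longlonglongrightarrow> ?l + 0"
      by (intro tendsto_intros S shift)+
    ultimately show "?Q \<longlonglongrightarrow> ?l"
      using upper
      by (intro tendsto_sandwich[of "\<lambda>n. ?l - ?l / real n" ?Q _ "\<lambda>n. ?l + ?S n"])
         (auto intro: eventually_mono[OF eventually_gt_at_top[of 0]])
  qed
qed

lemma card_non_one_indices_le:
  assumes "x \<in> unit_irrationals"
  shows "real (card (non_one_indices x n)) * ln 2 \<le> (\<Sum>j = 1..n. ln (real_of_int (cf_digit x j)))"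
proof -
  have digit: "\<And>j. cf_digit x j \<ge> 1"
    using cf_digit_pos[OF assms] .
  have "real (card (non_one_indices x n)) * ln 2 = (\<Sum>j\<in>non_one_indices x n. ln 2)"
    by simp
  also have "\<dots> \<le> (\<Sum>j\<in>non_one_indices x n. ln (real_of_int (cf_digit x j)))"
  proof (rule sum_mono)
    fix j assume "j \<in> non_one_indices x n"
    hence "cf_digit x j \<ge> 2"
      using digit[of j] by (simp add: non_one_indices_def)
    thus "ln 2 \<le> ln (real_of_int (cf_digit x j))"
      by simp
  qed
  also have "\<dots> \<le> (\<Sum>j = 1..n. ln (real_of_int (cf_digit x j)))"
    using digit by (intro sum_mono2) (auto simp: non_one_indices_def)
  finally show ?thesis .
qed

lemma non_one_indices_density_zero:
  assumes "x \<in> unit_irrationals"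
    and S: "(\<lambda>n. 1 / real n * (\<Sum>j = 1..n. ln (real_of_int (cf_digit x j)))) \<longlonglongrightarrow> 0"
  shows "(\<lambda>n. 1 / real n * real (card (non_one_indices x n))) \<longlonglongrightarrow> 0"
proof (rule tendsto_sandwich[of "\<lambda>_. 0"])
  let ?S = "\<lambda>n. 1 / real n * (\<Sum>j = 1..n. ln (real_of_int (cf_digit x j)))"
  show "(\<lambda>n. ?S n / ln 2) \<longlonglongrightarrow> 0"
    using tendsto_divide[OF S tendsto_const, of "ln 2"] by simp
  have "1 / real n * real (card (non_one_indices x n)) \<le> ?S n / ln 2" for n
    using mult_left_mono[OF card_non_one_indices_le[OF assms(1), of n], of "1 / real n"]
    by (subst pos_le_divide_eq) (simp_all add: mult.assoc)
  thus "\<forall>\<^sub>F n in sequentially. 1 / real n * real (card (non_one_indices x n)) \<le> ?S n / ln 2"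
    by simp
qed auto

theorem lemma2p8:
  fixes A B C :: "real set"
  assumes "A = {x \<in> unit_irrationals.
      (\<lambda>n. 1 / real n * ln (real_of_int (cf_denom x n))) \<longlonglongrightarrow> gamma0 / 2}"
    and "B = {x \<in> unit_irrationals.
      (\<lambda>n. 1 / real n * (\<Sum>j = 1..n. ln (real_of_int (cf_digit x j)))) \<longlonglongrightarrow> 0}"
    and "C = {x \<in> unit_irrationals.
      (\<lambda>n. 1 / real n * real (card (non_one_indices x n))) \<longlonglongrightarrow> 0}"
  shows "A = B \<and> B \<subseteq> C"
proof -
  have "gamma0 / 2 = ln golden_ratio"
    by (simp add: gamma0_def golden_ratio_def)
  hence "A = B"
    unfolding assms using ln_cf_denom_limit_iff by (intro Collect_cong) (auto simp only:)
  moreover have "B \<subseteq> C"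
    unfolding assms using non_one_indices_density_zero by blast
  ultimately show ?thesis ..
qed

end
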